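(* Let $\mathcal{L}$ be a complex five-dimensional solvable, non-nilpotent, non-split, non-Lie symmetric Leibniz algebra whose underlying Lie algebra is the five-dimensional Lie algebra $\mathcal{G}$ with basis $e_1,\dots,e_5$ and nonzero brackets $[e_1,e_2]=e_1$, $[e_3,e_4]=e_3$ (up to antisymmetry). Then $\mathcal{L}$ is isomorphic to one of the following non-isomorphic algebras (only nonzero products of basis elements are listed): $\mathcal{L}_{69}^{\alpha,\beta}$ ($\alpha,\beta\in\mathbb{C}$): $e_1\cdot e_2=e_1$, $e_2\cdot e_1=-e_1$, $e_3\cdot e_4=e_3$, $e_4\cdot e_3=-e_3$, $e_2\cdot e_2=\alpha e_5$, $e_2\cdot e_4=e_5$, $e_4\cdot e_2=e_5$, $e_4\cdot e_4=\beta e_5$; $\mathcal{L}_{70}^{\alpha}$ ($\alpha\in\mathbb{C}$, $\alpha\neq0$): $e_1\cdot e_2=e_1$, $e_2\cdot e_1=-e_1$, $e_3\cdot e_4=e_3$, $e_4\cdot e_3=-e_3$, $e_2\cdot e_2=\alpha e_5$, $e_4\cdot e_4=e_5$; where $\mathcal{L}_{69}^{\alpha,\beta}\cong\mathcal{L}_{69}^{\beta,\alpha}$ and $\mathcal{L}_{70}^{\alpha}\cong\mathcal{L}_{70}^{1/\alpha}$.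
   Context: All algebras are finite-dimensional over $\mathbb{C}$. A symmetric Leibniz algebra is a vector space $\mathcal{L}$ with a bilinear product $\cdot$ satisfying $x\cdot(y\cdot z)=(x\cdot y)\cdot z+y\cdot(x\cdot z)$ and $(x\cdot y)\cdot z=x\cdot(y\cdot z)+(x\cdot z)\cdot y$ for all $x,y,z$. Put $[x,y]=\frac12(x\cdot y-y\cdot x)$; then $(\mathcal{L},[-,-])$ is a Lie algebra, called the underlying Lie algebra. $\mathcal{L}$ is solvable if $\mathcal{L}^{[s]}=0$ for some $s$, where $\mathcal{L}^{[1]}=\mathcal{L}$, $\mathcal{L}^{[s+1]}=\mathcal{L}^{[s]}\cdot\mathcal{L}^{[s]}$; nilpotent if $\mathcal{L}^k=0$ for some $k$, where $\mathcal{L}^1=\mathcal{L}$, $\mathcal{L}^{k+1}=\mathcal{L}^k\cdot\mathcal{L}$. An algebra is split if it is a direct sum of two nonzero ideals; non-Lie means $(\mathcal{L},\cdot)$ is not a Lie algebra. Every algebra in the claim has basis $e_1,\dots,e_5$. The listed algebras are non-isomorphic for different families or different parameters, apart from the stated parameter identifications. *)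

theory Defs
  imports "HOL-Analysis.Analysis"
begin

text \<open>
  An algebra is an abstract complex vector space, given by its scalar multiplication on a type
  of class \<^class>\<open>ab_group_add\<close>, together with a bilinear product. No finiteness is
  built in: \<open>dim\<close> is \<open>0\<close> on infinite-dimensional spaces, so \<open>dim UNIV = 5\<close>
  forces finite dimension.
\<close>

locale complex_algebra = vector_space scale
  for scale :: "complex \<Rightarrow> 'a::ab_group_add \<Rightarrow> 'a" +
  fixes mul :: "'a \<Rightarrow> 'a \<Rightarrow> 'a"  (infixl "\<cdot>" 70)
  assumes linear_mul_right: "\<And>x. Vector_Spaces.linear scale scale (\<lambda>y. x \<cdot> y)"
    and linear_mul_left: "\<And>y. Vector_Spaces.linear scale scale (\<lambda>x. x \<cdot> y)"
begin

definition set_mul :: "'a set \<Rightarrow> 'a set \<Rightarrow> 'a set" where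
  "set_mul A B = span {a \<cdot> b | a b. a \<in> A \<and> b \<in> B}"

text \<open>
  The two series are indexed from \<open>0\<close>: \<open>derived_series s\<close> is
  \<open>L\<^sup>[\<^sup>s\<^sup>+\<^sup>1\<^sup>]\<close> and
  \<open>power_series k\<close> is \<open>L\<^sup>k\<^sup>+\<^sup>1\<close> in the usual numbering, which starts with the
  whole algebra at \<open>1\<close>.
\<close>

primrec derived_series :: "nat \<Rightarrow> 'a set" where
  "derived_series 0 = UNIV"
| "derived_series (Suc s) = set_mul (derived_series s) (derived_series s)"

primrec power_series :: "nat \<Rightarrow> 'a set" where
  "power_series 0 = UNIV"
| "power_series (Suc k) = set_mul (power_series k) UNIV"

definition solvable :: bool where
  "solvable \<longleftrightarrow> (\<exists>s. derived_series s = {0})"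

definition nilpotent :: bool where
  "nilpotent \<longleftrightarrow> (\<exists>k. power_series k = {0})"

definition is_ideal :: "'a set \<Rightarrow> bool" where
  "is_ideal I \<longleftrightarrow> subspace I \<and> (\<forall>x. \<forall>y\<in>I. x \<cdot> y \<in> I \<and> y \<cdot> x \<in> I)"

definition split :: bool where
  "split \<longleftrightarrow> (\<exists>I J. is_ideal I \<and> is_ideal J \<and> I \<noteq> {0} \<and> J \<noteq> {0} \<and>
     I \<inter> J = {0} \<and> {i + j | i j. i \<in> I \<and> j \<in> J} = UNIV)"

definition is_Lie :: bool where
  "is_Lie \<longleftrightarrow> (\<forall>x. x \<cdot> x = 0) \<and>
     (\<forall>x y z. x \<cdot> (y \<cdot> z) + y \<cdot> (z \<cdot> x) + z \<cdot> (x \<cdot> y) = 0)"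

definition lie_bracket :: "'a \<Rightarrow> 'a \<Rightarrow> 'a" where
  "lie_bracket x y = scale (1/2) (x \<cdot> y - y \<cdot> x)"

end

locale symmetric_leibniz_algebra = complex_algebra +
  assumes left_leibniz: "\<And>x y z. x \<cdot> (y \<cdot> z) = (x \<cdot> y) \<cdot> z + y \<cdot> (x \<cdot> z)"
    and right_leibniz: "\<And>x y z. (x \<cdot> y) \<cdot> z = x \<cdot> (y \<cdot> z) + (x \<cdot> z) \<cdot> y"

definition algebra_isomorphic ::
  "(complex \<Rightarrow> 'a::ab_group_add \<Rightarrow> 'a) \<Rightarrow> ('a \<Rightarrow> 'a \<Rightarrow> 'a) \<Rightarrow>
   (complex \<Rightarrow> 'b::ab_group_add \<Rightarrow> 'b) \<Rightarrow> ('b \<Rightarrow> 'b \<Rightarrow> 'b) \<Rightarrow> bool" where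
  "algebra_isomorphic scale1 mul1 scale2 mul2 \<longleftrightarrow>
     (\<exists>f. Vector_Spaces.linear scale1 scale2 f \<and> bij f \<and>
          (\<forall>x y. f (mul1 x y) = mul2 (f x) (f y)))"

text \<open>
  The concrete algebras live on \<^typ>\<open>complex^5\<close> and are given by their tables of products of
  basis vectors. In the index type \<open>5\<close> the numeral \<open>5\<close> equals \<open>0\<close>, so
  \<open>1, 2, 3, 4, 5\<close> are its five distinct elements.
\<close>

definition e :: "5 \<Rightarrow> complex^5" where
  "e i = axis i 1"

definition table_mul :: "(5 \<Rightarrow> 5 \<Rightarrow> complex^5) \<Rightarrow> complex^5 \<Rightarrow> complex^5 \<Rightarrow> complex^5" where
  "table_mul c x y = (\<Sum>i\<in>UNIV. \<Sum>j\<in>UNIV. (x $ i * y $ j) *s c i j)"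

definition G_bracket :: "complex^5 \<Rightarrow> complex^5 \<Rightarrow> complex^5" where
  "G_bracket = table_mul (\<lambda>i j.
     if (i, j) = (1, 2) then e 1
     else if (i, j) = (2, 1) then - e 1
     else if (i, j) = (3, 4) then e 3
     else if (i, j) = (4, 3) then - e 3
     else 0)"

definition L69 :: "complex \<Rightarrow> complex \<Rightarrow> complex^5 \<Rightarrow> complex^5 \<Rightarrow> complex^5" where
  "L69 \<alpha> \<beta> = table_mul (\<lambda>i j.
     if (i, j) = (1, 2) then e 1
     else if (i, j) = (2, 1) then - e 1
     else if (i, j) = (3, 4) then e 3
     else if (i, j) = (4, 3) then - e 3
     else if (i, j) = (2, 2) then \<alpha> *s e 5
     else if (i, j) = (2, 4) then e 5
     else if (i, j) = (4, 2) then e 5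
     else if (i, j) = (4, 4) then \<beta> *s e 5
     else 0)"

definition L70 :: "complex \<Rightarrow> complex^5 \<Rightarrow> complex^5 \<Rightarrow> complex^5" where
  "L70 \<alpha> = table_mul (\<lambda>i j.
     if (i, j) = (1, 2) then e 1
     else if (i, j) = (2, 1) then - e 1
     else if (i, j) = (3, 4) then e 3
     else if (i, j) = (4, 3) then - e 3
     else if (i, j) = (2, 2) then \<alpha> *s e 5
     else if (i, j) = (4, 4) then e 5
     else 0)"

end

theory Submission
  imports Defs
begin

text \<open>
  Write the product as \<open>x \<cdot> y = [x, y] + x \<circ> y\<close>, the sum of its skew-symmetric and its
  symmetric part. The symmetric Leibniz identities force every \<open>x \<circ> y\<close> to annihilate the algebra
  on both sides, and force \<open>\<circ>\<close> to vanish on brackets. When the bracket is that of \<open>G\<close>, whose centre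
  is the line of \<open>e\<^sub>5\<close> and whose derived algebra is spanned by \<open>e\<^sub>1, e\<^sub>3\<close>, this means that
  \<open>x \<circ> y = B(x, y) e\<^sub>5\<close>, where \<open>B\<close> is a symmetric bilinear form in the coordinates along \<open>e\<^sub>2\<close> and
  \<open>e\<^sub>4\<close> alone. So the algebras with underlying Lie algebra \<open>G\<close> form a family with three parameters,
  \<open>(a, b, c) = (B(e\<^sub>2, e\<^sub>2), B(e\<^sub>2, e\<^sub>4), B(e\<^sub>4, e\<^sub>4))\<close> (\<open>G_extensionI\<close>), and \<open>L69 \<alpha> \<beta>\<close>, \<open>L70 \<alpha>\<close> are
  its members \<open>(\<alpha>, 1, \<beta>)\<close>, \<open>(\<alpha>, 0, 1)\<close>.

  An isomorphism between two members respects the brackets and hence the two weights by which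
  \<open>G\<close> acts on its derived algebra, up to exchanging them. Modulo the derived algebra and the centre
  it therefore either fixes both of \<open>e\<^sub>2, e\<^sub>4\<close> or exchanges them, while it multiplies \<open>e\<^sub>5\<close> by some
  \<open>k \<noteq> 0\<close>. Thus two triples give isomorphic algebras exactly if they are proportional, possibly
  after exchanging \<open>a\<close> and \<open>c\<close> (\<open>G_extension_isomorphic_iff\<close>). If \<open>b \<noteq> 0\<close>, the triple is proportional to
  a unique \<open>(\<alpha>, 1, \<beta>)\<close>. If \<open>b = 0\<close> and \<open>a, c \<noteq> 0\<close>, it is proportional to a unique \<open>(\<alpha>, 0, 1)\<close>, with \<open>\<alpha> \<noteq> 0\<close>.
  In the remaining cases \<open>b = 0\<close> and \<open>ac = 0\<close>, the algebra splits into the ideals containing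
  \<open>e\<^sub>1, e\<^sub>2\<close> and \<open>e\<^sub>3, e\<^sub>4\<close>, because the centre is then needed by at most one of them.
\<close>

section \<open>Symmetric Leibniz identities\<close>

context complex_algebra
begin

lemma mul_add_left: "(x + y) \<cdot> z = x \<cdot> z + y \<cdot> z"
  and mul_add_right: "z \<cdot> (x + y) = z \<cdot> x + z \<cdot> y"
  and mul_scale_left: "scale k x \<cdot> z = scale k (x \<cdot> z)"
  and mul_scale_right: "z \<cdot> scale k x = scale k (z \<cdot> x)"
  using linear_mul_left[of z] linear_mul_right[of z] by (simp_all add: Vector_Spaces.linear_iff)

end

lemma complex_algebraI:
  fixes scale :: "complex \<Rightarrow> 'a::ab_group_add \<Rightarrow> 'a"
  assumes "vector_space scale"
    and "\<And>x y z. mul (x + y) z = mul x z + mul y z" "\<And>x y z. mul z (x + y) = mul z x + mul z y"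
    and "\<And>k x z. mul (scale k x) z = scale k (mul x z)"
    and "\<And>k x z. mul z (scale k x) = scale k (mul z x)"
  shows "complex_algebra scale mul"
  using assms by (simp add: complex_algebra_def complex_algebra_axioms_def Vector_Spaces.linear_iff)

context symmetric_leibniz_algebra
begin

text \<open>
  Exchanging \<open>x\<close> and \<open>y\<close> in the left Leibniz identity and adding the two versions cancels
  everything but the left side below. The right identity yields the mirror image.
\<close>

lemma symmetrised_mul_left_zero: "(x \<cdot> y + y \<cdot> x) \<cdot> z = 0"
proof -
  have "x \<cdot> (y \<cdot> z) = ((x \<cdot> y) \<cdot> z + (y \<cdot> x) \<cdot> z) + x \<cdot> (y \<cdot> z)"
    using left_leibniz[of x y z] left_leibniz[of y x z] by (simp add: add.assoc)
  then show ?thesis by (simp add: mul_add_left)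
qed

lemma symmetrised_mul_right_zero: "z \<cdot> (x \<cdot> y + y \<cdot> x) = 0"
proof -
  have "(z \<cdot> x) \<cdot> y = (z \<cdot> (x \<cdot> y) + z \<cdot> (y \<cdot> x)) + (z \<cdot> x) \<cdot> y"
    using right_leibniz[of z x y] right_leibniz[of z y x] by (simp add: add.assoc)
  then show ?thesis by (simp add: mul_add_right)
qed

text \<open>
  Since \<open>[x, y]\<close> is a combination of \<open>x \<cdot> y\<close> and \<open>y \<cdot> x\<close>, this makes the symmetric part of the product
  vanish on brackets. As \<open>u \<cdot> (v \<cdot> w)\<close> changes sign when \<open>v\<close> and \<open>w\<close> are exchanged, the left identity
  expresses \<open>(x \<cdot> y) \<cdot> z\<close> by products of the form \<open>u \<cdot> (z \<cdot> v)\<close>, and the two identities for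
  products starting with \<open>z\<close> reduce these to \<open>z \<cdot> (x \<cdot> y)\<close>.
\<close>

lemma product_anticommutes: "(x \<cdot> y) \<cdot> z + z \<cdot> (x \<cdot> y) = 0"
proof -
  have rev: "u \<cdot> (v \<cdot> w) = - (u \<cdot> (w \<cdot> v))" for u v w
    using symmetrised_mul_right_zero[of u v w] by (simp add: mul_add_right eq_neg_iff_add_eq_0)
  have 1: "(x \<cdot> y) \<cdot> z = y \<cdot> (z \<cdot> x) - x \<cdot> (z \<cdot> y)"
    using left_leibniz[of x y z] rev[of x y z] rev[of y x z] by (simp add: algebra_simps)
  have 2: "x \<cdot> (z \<cdot> y) = z \<cdot> (x \<cdot> y) - (z \<cdot> x) \<cdot> y"
    using left_leibniz[of z x y] by (simp add: algebra_simps)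
  have 3: "y \<cdot> (z \<cdot> x) = - (z \<cdot> (x \<cdot> y)) - (z \<cdot> y) \<cdot> x"
    using left_leibniz[of z y x] rev[of z y x] by (simp add: algebra_simps)
  have 4: "(z \<cdot> x) \<cdot> y = z \<cdot> (x \<cdot> y) + (z \<cdot> y) \<cdot> x"
    by (rule right_leibniz)
  show ?thesis using 1 2 3 4 by (simp add: algebra_simps)
qed

end

section \<open>Transport along linear bijections\<close>

lemma symmetric_leibniz_algebra_transport:
  fixes scale :: "complex \<Rightarrow> 'a::ab_group_add \<Rightarrow> 'a"
  assumes A: "symmetric_leibniz_algebra scale mul"
    and lin: "Vector_Spaces.linear scale scale' f" and bij: "bij f"
  shows "symmetric_leibniz_algebra scale' (\<lambda>x y. f (mul (inv f x) (inv f y)))"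
proof -
  interpret A: symmetric_leibniz_algebra scale mul by (rule A)
  have f: "f (x + y) = f x + f y" "f (scale k x) = scale' k (f x)" "vector_space scale'" for x y k
    using lin by (auto simp: Vector_Spaces.linear_iff)
  have [simp]: "inv f (f x) = x" "f (inv f y) = y" for x y
    using bij by (simp_all add: bij_is_inj bij_is_surj surj_f_inv_f)
  have g: "inv f (x + y) = inv f x + inv f y" for x y
    using f(1)[of "inv f x" "inv f y"] bij by (metis bij_inv_eq_iff)
  have g': "inv f (scale' k x) = scale k (inv f x)" for k x
    using f(2)[of k "inv f x"] bij by (metis bij_inv_eq_iff)
  show ?thesis
  proof (intro symmetric_leibniz_algebra.intro symmetric_leibniz_algebra_axioms.intro
      complex_algebraI)
    show "vector_space scale'" by (rule f)
  next
    fix x y z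
    show "f (mul (inv f x) (inv f (f (mul (inv f y) (inv f z))))) =
        f (mul (inv f (f (mul (inv f x) (inv f y)))) (inv f z)) +
        f (mul (inv f y) (inv f (f (mul (inv f x) (inv f z)))))"
      using A.left_leibniz[of "inv f x" "inv f y" "inv f z"] by (simp add: f(1)[symmetric])
  next
    fix x y z
    show "f (mul (inv f (f (mul (inv f x) (inv f y)))) (inv f z)) =
        f (mul (inv f x) (inv f (f (mul (inv f y) (inv f z))))) +
        f (mul (inv f (f (mul (inv f x) (inv f z)))) (inv f y))"
      using A.right_leibniz[of "inv f x" "inv f y" "inv f z"] by (simp add: f(1)[symmetric])
  qed (simp_all add: f g g' A.mul_add_left A.mul_add_right A.mul_scale_left A.mul_scale_right)
qed

lemma algebra_isomorphic_trans:
  assumes "algebra_isomorphic s1 m1 s2 m2" "algebra_isomorphic s2 m2 s3 m3"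
  shows "algebra_isomorphic s1 m1 s3 m3"
proof -
  obtain f g where f: "Vector_Spaces.linear s1 s2 f" "bij f" "\<And>x y. f (m1 x y) = m2 (f x) (f y)"
    and g: "Vector_Spaces.linear s2 s3 g" "bij g" "\<And>x y. g (m2 x y) = m3 (g x) (g y)"
    using assms unfolding algebra_isomorphic_def by metis
  then show ?thesis
    unfolding algebra_isomorphic_def
    by (intro exI[of _ "g \<circ> f"]) (simp add: Vector_Spaces.linear_compose bij_comp)
qed

lemma split_isomorphic:
  assumes A: "complex_algebra s1 m1" and B: "complex_algebra s2 m2"
    and iso: "algebra_isomorphic s1 m1 s2 m2" and split: "complex_algebra.split s2 m2"
  shows "complex_algebra.split s1 m1"
proof -
  interpret A: complex_algebra s1 m1 by (rule A)
  interpret B: complex_algebra s2 m2 by (rule B)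
  obtain f where lin: "Vector_Spaces.linear s1 s2 f" and bij: "bij f"
    and hom: "\<And>x y. f (m1 x y) = m2 (f x) (f y)"
    using iso unfolding algebra_isomorphic_def by blast
  have f: "f (x + y) = f x + f y" "f (s1 k x) = s2 k (f x)" for x y k
    using lin by (auto simp: Vector_Spaces.linear_iff)
  have f0: "f 0 = 0"
    using f(1)[of 0 0] by simp
  have f_eq_0: "f x = 0 \<longleftrightarrow> x = 0" for x
    using bij f0 by (metis bij_is_inj injD)
  have surj: "\<exists>x. f x = y" for y
    using bij by (metis bij_is_surj surjD)
  obtain I J where I: "B.is_ideal I" "I \<noteq> {0}" and J: "B.is_ideal J" "J \<noteq> {0}"
    and IJ: "I \<inter> J = {0}" "{i + j | i j. i \<in> I \<and> j \<in> J} = UNIV"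
    using split unfolding B.split_def by blast
  have ideal: "A.is_ideal (f -` K)" if "B.is_ideal K" for K
    using that unfolding A.is_ideal_def B.is_ideal_def A.subspace_def B.subspace_def
    by (auto simp: f f0 hom)
  have nontrivial: "f -` K \<noteq> {0}" if K: "B.is_ideal K" "K \<noteq> {0}" for K
  proof -
    have "0 \<in> K" using K(1) by (simp add: B.is_ideal_def B.subspace_def)
    then obtain y where "y \<in> K" "y \<noteq> 0" using K(2) by blast
    moreover obtain x where "y = f x" using surj by metis
    ultimately have "x \<in> f -` K" "x \<noteq> 0" using f0 by auto
    then show ?thesis by blast
  qed
  have sum: "x \<in> {i + j | i j. i \<in> f -` I \<and> j \<in> f -` J}" for x
  proof -
    obtain i j where ij: "i \<in> I" "j \<in> J" "f x = i + j" using IJ(2) by blast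
    obtain i' j' where "f i' = i" "f j' = j" using surj by metis
    moreover have "x = i' + j'"
      using calculation ij(3) f(1) bij by (metis bij_is_inj injD)
    ultimately show ?thesis using ij by blast
  qed
  have "f -` I \<inter> f -` J = {0}"
    using IJ(1) f_eq_0 by auto
  moreover have "{i + j | i j. i \<in> f -` I \<and> j \<in> f -` J} = UNIV"
    using sum by (intro set_eqI iffI UNIV_I)
  ultimately show ?thesis
    unfolding A.split_def using ideal[OF I(1)] ideal[OF J(1)] nontrivial[OF I] nontrivial[OF J]
    by (intro exI[of _ "f -` I"] exI[of _ "f -` J"] conjI)
qed

section \<open>The extensions of the Lie algebra by a form in its second and fourth coordinates\<close>

lemma exhaust_5: "(x::5) = 1 \<or> x = 2 \<or> x = 3 \<or> x = 4 \<or> x = 5"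
proof (induct x)
  case (of_int z)
  then have "z = 0 \<or> z = 1 \<or> z = 2 \<or> z = 3 \<or> z = 4" by auto
  then show ?case by auto
qed

lemma forall_5: "(\<forall>i::5. P i) \<longleftrightarrow> P 1 \<and> P 2 \<and> P 3 \<and> P 4 \<and> P 5"
  by (metis exhaust_5)

lemma UNIV_5: "(UNIV::5 set) = {1, 2, 3, 4, 5}"
  using exhaust_5 by auto

lemma sum_5: "sum f (UNIV::5 set) = f 1 + f 2 + f 3 + f 4 + f 5"
  unfolding UNIV_5 by (simp add: add.assoc)

lemma table_mul_nth: "table_mul c x y $ k = (\<Sum>i\<in>UNIV. \<Sum>j\<in>UNIV. x $ i * y $ j * c i j $ k)"
  by (simp add: table_mul_def)

lemma e_nth: "e i $ j = (if j = i then 1 else 0)"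
  by (simp add: e_def axis_def)

lemma G_bracket_nth:
  "G_bracket x y $ 1 = x $ 1 * y $ 2 - x $ 2 * y $ 1" "G_bracket x y $ 2 = 0"
  "G_bracket x y $ 3 = x $ 3 * y $ 4 - x $ 4 * y $ 3" "G_bracket x y $ 4 = 0"
  "G_bracket x y $ 5 = 0"
  by (simp_all add: G_bracket_def table_mul_nth sum_5 e_nth)

definition G_extension :: "complex \<Rightarrow> complex \<Rightarrow> complex \<Rightarrow> complex^5 \<Rightarrow> complex^5 \<Rightarrow> complex^5" where
  "G_extension a b c x y = G_bracket x y +
     (a * x $ 2 * y $ 2 + b * (x $ 2 * y $ 4 + x $ 4 * y $ 2) + c * x $ 4 * y $ 4) *s e 5"

lemma G_extension_nth:
  "G_extension a b c x y $ 1 = x $ 1 * y $ 2 - x $ 2 * y $ 1"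
  "G_extension a b c x y $ 2 = 0"
  "G_extension a b c x y $ 3 = x $ 3 * y $ 4 - x $ 4 * y $ 3"
  "G_extension a b c x y $ 4 = 0"
  "G_extension a b c x y $ 5 =
     a * x $ 2 * y $ 2 + b * (x $ 2 * y $ 4 + x $ 4 * y $ 2) + c * x $ 4 * y $ 4"
  by (simp_all add: G_extension_def G_bracket_nth e_nth)

lemma L69_eq_G_extension: "L69 \<alpha> \<beta> = G_extension \<alpha> 1 \<beta>"
  by (intro ext)
    (simp add: vec_eq_iff forall_5 G_extension_nth L69_def table_mul_nth sum_5 e_nth algebra_simps)

lemma L70_eq_G_extension: "L70 \<alpha> = G_extension \<alpha> 0 1"
  by (intro ext)
    (simp add: vec_eq_iff forall_5 G_extension_nth L70_def table_mul_nth sum_5 e_nth algebra_simps)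

lemma complex_algebra_G_extension: "complex_algebra (*s) (G_extension a b c)"
  by (rule complex_algebraI)
    (auto simp: vec.vector_space_axioms vec_eq_iff forall_5 G_extension_nth algebra_simps)

lemma vec5_basis_expansion:
  "(x :: complex^5) = x $ 1 *s e 1 + x $ 2 *s e 2 + x $ 3 *s e 3 + x $ 4 *s e 4 + x $ 5 *s e 5"
  by (simp add: vec_eq_iff forall_5 e_nth)

lemma G_central_imp_line:
  assumes "\<And>y. G_bracket x y = 0"
  shows "x = x $ 5 *s e 5"
proof -
  have "G_bracket x (e 1) $ 1 = 0" "G_bracket x (e 2) $ 1 = 0"
    "G_bracket x (e 3) $ 3 = 0" "G_bracket x (e 4) $ 3 = 0"
    using assms by simp_all
  then show ?thesis by (simp add: vec_eq_iff forall_5 G_bracket_nth e_nth)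
qed

text \<open>
  The symmetric part of the product takes values in the centre of \<open>G\<close> and vanishes on its
  derived algebra. That it also vanishes on \<open>e\<^sub>5\<close> holds because \<open>e\<^sub>5\<close>, as soon as the symmetric
  part is nonzero, is one of its values up to a factor, and these values annihilate the algebra.
\<close>

lemma G_extensionI:
  assumes "symmetric_leibniz_algebra (*s) m"
    and bracket: "\<And>x y. (1/2) *s (m x y - m y x) = G_bracket x y"
  shows "\<exists>a b c. m = G_extension a b c"
proof -
  interpret symmetric_leibniz_algebra "(*s)" m by fact
  note bilinear = mul_add_left mul_add_right mul_scale_left mul_scale_right
  define J where "J x y = (1/2) *s (m x y + m y x)" for x y
  have J_add: "J (x + y) z = J x z + J y z" "J z (x + y) = J z x + J z y" for x y z
    by (simp_all add: J_def bilinear vec_eq_iff field_simps)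
  have J_scale: "J (k *s x) z = k *s J x z" "J z (k *s x) = k *s J z x" for k x z
    by (simp_all add: J_def bilinear vec_eq_iff field_simps)
  have J_commute: "J x y = J y x" for x y
    by (simp add: J_def add.commute)
  have m_eq: "m x y = G_bracket x y + J x y" for x y
    by (simp add: J_def bracket[symmetric] vec_eq_iff field_simps)
  have J_annihilates: "m (J x y) z = 0" "m z (J x y) = 0" for x y z
    using symmetrised_mul_left_zero[of x y z] symmetrised_mul_right_zero[of z x y]
    unfolding J_def mul_scale_left mul_scale_right by simp_all
  have J_line: "J x y = J x y $ 5 *s e 5" for x y
    by (rule G_central_imp_line) (simp add: bracket[symmetric] J_annihilates)
  have J_product: "J (m x y) z = 0" for x y z
    by (simp only: J_def product_anticommutes vec.scale_zero_right)
  have J_bracket: "J (G_bracket x y) z = 0" for x y z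
  proof -
    have eq: "G_bracket x y = (1/2) *s m x y + (- 1/2) *s m y x"
      by (simp add: bracket[symmetric] vec_eq_iff field_simps)
    show ?thesis unfolding eq J_add J_scale J_product by simp
  qed
  have "e 1 = G_bracket (e 1) (e 2)" "e 3 = G_bracket (e 3) (e 4)"
    by (simp_all add: vec_eq_iff forall_5 G_bracket_nth e_nth)
  then have J1: "J (e 1) z = 0" and J3: "J (e 3) z = 0" for z
    using J_bracket by metis+
  have J5: "J (e 5) z = 0" for z
  proof (cases "\<exists>x y. J x y $ 5 \<noteq> 0")
    case True
    then obtain x y where k: "J x y $ 5 \<noteq> 0" by blast
    have "J (J x y) z = 0" by (simp add: J_def[of "J x y"] J_annihilates)
    then have "J x y $ 5 *s J (e 5) z = 0" using J_line[of x y] J_scale(1) by metis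
    then show ?thesis using k by simp
  next
    case False
    then show ?thesis using J_line[of "e 5" z] by simp
  qed
  have J_left: "J x z = x $ 2 *s J (e 2) z + x $ 4 *s J (e 4) z" for x z
    by (subst vec5_basis_expansion[of x]) (simp add: J_add J_scale J1 J3 J5)
  have J_right: "J z x = x $ 2 *s J z (e 2) + x $ 4 *s J z (e 4)" for x z
    using J_left[of x z] J_commute by simp
  define a b c where abc: "a = J (e 2) (e 2) $ 5" "b = J (e 2) (e 4) $ 5" "c = J (e 4) (e 4) $ 5"
  have J_values: "J (e 2) (e 2) = a *s e 5" "J (e 2) (e 4) = b *s e 5"
    "J (e 4) (e 2) = b *s e 5" "J (e 4) (e 4) = c *s e 5"
    using J_line J_commute[of "e 4" "e 2"] by (simp_all add: abc)
  have "m x y = G_extension a b c x y" for x y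
    unfolding m_eq G_extension_def
    by (subst J_left, subst (1 2) J_right, simp add: J_values vec_eq_iff e_nth algebra_simps)
  then show ?thesis by blast
qed

section \<open>Isomorphisms between the extensions\<close>

lemma G_extension_scale:
  assumes "k \<noteq> 0"
  shows "algebra_isomorphic (*s) (G_extension a b c) (*s) (G_extension (k * a) (k * b) (k * c))"
proof -
  define f where "f k x = (\<chi> i. if i = 5 then k * x $ 5 else x $ i)" for k and x :: "complex^5"
  have f_nth: "f k x $ i = (if i = 5 then k * x $ 5 else x $ i)" for k x i
    by (simp add: f_def)
  have inverse: "f (1/k) \<circ> f k = id" "f k \<circ> f (1/k) = id"
    using assms by (auto simp: fun_eq_iff vec_eq_iff f_nth)
  show ?thesis
    unfolding algebra_isomorphic_def
  proof (intro exI[of _ "f k"] conjI allI)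
    show "Vector_Spaces.linear (*s) (*s) (f k)"
      by (auto simp: Vector_Spaces.linear_iff vec.vector_space_axioms vec_eq_iff f_nth
          algebra_simps)
    show "bij (f k)"
      by (rule o_bij[OF inverse])
    show "f k (G_extension a b c x y) =
        G_extension (k * a) (k * b) (k * c) (f k x) (f k y)" for x y
      by (simp add: vec_eq_iff forall_5 G_extension_nth f_nth algebra_simps)
  qed
qed

lemma G_extension_swap:
  "algebra_isomorphic (*s) (G_extension a b c) (*s) (G_extension c b a)"
proof -
  define p :: "5 \<Rightarrow> 5" where
    "p i = (if i = 1 then 3 else if i = 2 then 4 else if i = 3 then 1 else if i = 4 then 2 else i)" for i
  define f where "f x = (\<chi> i. x $ p i)" for x :: "complex^5"
  have f_nth: "f x $ i = x $ p i" for x i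
    by (simp add: f_def)
  have p: "p 1 = 3" "p 2 = 4" "p 3 = 1" "p 4 = 2" "p 5 = 5"
    by (simp_all add: p_def)
  have inverse: "f \<circ> f = id"
    by (auto simp: fun_eq_iff vec_eq_iff forall_5 f_nth p)
  show ?thesis
    unfolding algebra_isomorphic_def
  proof (intro exI[of _ f] conjI allI)
    show "Vector_Spaces.linear (*s) (*s) f"
      by (auto simp: Vector_Spaces.linear_iff vec.vector_space_axioms vec_eq_iff f_nth)
    show "bij f"
      by (rule o_bij[OF inverse inverse])
    show "f (G_extension a b c x y) = G_extension c b a (f x) (f y)" for x y
      by (simp add: vec_eq_iff forall_5 G_extension_nth f_nth p algebra_simps)
  qed
qed

text \<open>
  Compatibility with the brackets says that the images of \<open>e\<^sub>1\<close> and \<open>e\<^sub>3\<close> are common eigenvectors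
  in the span of \<open>e\<^sub>1, e\<^sub>3\<close> for the images of \<open>e\<^sub>2\<close> and \<open>e\<^sub>4\<close>. The eigenvalues \<open>1\<close> and \<open>0\<close> determine the
  second and fourth coordinates of these images, up to the exchange.
\<close>

lemma G_extension_isomorphic_imp:
  assumes "algebra_isomorphic (*s) (G_extension a b c) (*s) (G_extension a' b' c')"
  shows "\<exists>k. k \<noteq> 0 \<and>
    ((a', b', c') = (k * a, k * b, k * c) \<or> (a', b', c') = (k * c, k * b, k * a))"
proof -
  let ?m = "G_extension a b c" and ?n = "G_extension a' b' c'"
  obtain f where lin: "Vector_Spaces.linear (*s) (*s) f" and bij: "bij f"
    and hom: "\<And>x y. f (?m x y) = ?n (f x) (f y)"
    using assms unfolding algebra_isomorphic_def by blast
  have f: "f (x + y) = f x + f y" "f (k *s x) = k *s f x" for x y k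
    using lin by (auto simp: Vector_Spaces.linear_iff)
  have f0: "f 0 = 0"
    using f(1)[of 0 0] by simp
  have f_eq_0: "f x = 0 \<longleftrightarrow> x = 0" for x
    using bij f0 by (metis bij_is_inj injD)
  have bracket: "f (G_bracket x y) = G_bracket (f x) (f y)" for x y
  proof -
    have "G_bracket x y = (1/2) *s ?m x y + (- 1/2) *s ?m y x"
      by (simp add: vec_eq_iff forall_5 G_extension_nth G_bracket_nth field_simps)
    then have "f (G_bracket x y) = (1/2) *s ?n (f x) (f y) + (- 1/2) *s ?n (f y) (f x)"
      by (simp only: f hom)
    also have "\<dots> = G_bracket (f x) (f y)"
      by (simp add: vec_eq_iff forall_5 G_extension_nth G_bracket_nth field_simps)
    finally show ?thesis .
  qed
  have "G_bracket (f (e 5)) y = 0" for y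
  proof -
    obtain x where "y = f x" using bij by (metis bij_pointE)
    moreover have "G_bracket (e 5) x = 0" by (simp add: vec_eq_iff forall_5 G_bracket_nth e_nth)
    ultimately show ?thesis using bracket[of "e 5" x] f0 by simp
  qed
  then obtain k where e5: "f (e 5) = k *s e 5"
    using G_central_imp_line by blast
  have e_neq_0: "e i \<noteq> 0" for i
    by (auto simp: vec_eq_iff e_nth)
  have "k \<noteq> 0"
    using e5 f_eq_0[of "e 5"] e_neq_0[of 5] by auto
  have "G_bracket (e 1) (e 2) = e 1" "G_bracket (e 3) (e 4) = e 3"
    "G_bracket (e 1) (e 4) = 0" "G_bracket (e 3) (e 2) = 0"
    by (simp_all add: vec_eq_iff forall_5 G_bracket_nth e_nth)
  then have eigen: "f (e 1) = G_bracket (f (e 1)) (f (e 2))" "f (e 3) = G_bracket (f (e 3)) (f (e 4))"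
    "0 = G_bracket (f (e 1)) (f (e 4))" "0 = G_bracket (f (e 3)) (f (e 2))"
    using bracket f0 by metis+
  have coords: "f (e 1) $ 2 = 0" "f (e 1) $ 4 = 0" "f (e 1) $ 5 = 0"
    "f (e 3) $ 2 = 0" "f (e 3) $ 4 = 0" "f (e 3) $ 5 = 0"
    using eigen(1,2) by (metis G_bracket_nth)+
  have weights1: "f (e 1) $ 1 = f (e 1) $ 1 * f (e 2) $ 2" "f (e 1) $ 3 = f (e 1) $ 3 * f (e 2) $ 4"
    "f (e 1) $ 1 * f (e 4) $ 2 = 0" "f (e 1) $ 3 * f (e 4) $ 4 = 0"
    using arg_cong[OF eigen(1), of "\<lambda>v. v $ 1"] arg_cong[OF eigen(1), of "\<lambda>v. v $ 3"]
      arg_cong[OF eigen(3), of "\<lambda>v. v $ 1"] arg_cong[OF eigen(3), of "\<lambda>v. v $ 3"]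
    by (simp_all add: G_bracket_nth coords)
  have weights3: "f (e 3) $ 1 = f (e 3) $ 1 * f (e 4) $ 2" "f (e 3) $ 3 = f (e 3) $ 3 * f (e 4) $ 4"
    "f (e 3) $ 1 * f (e 2) $ 2 = 0" "f (e 3) $ 3 * f (e 2) $ 4 = 0"
    using arg_cong[OF eigen(2), of "\<lambda>v. v $ 1"] arg_cong[OF eigen(2), of "\<lambda>v. v $ 3"]
      arg_cong[OF eigen(4), of "\<lambda>v. v $ 1"] arg_cong[OF eigen(4), of "\<lambda>v. v $ 3"]
    by (simp_all add: G_bracket_nth coords)
  have "f (e 1) \<noteq> 0" "f (e 3) \<noteq> 0"
    using f_eq_0 e_neq_0 by blast+
  then have "f (e 1) $ 1 \<noteq> 0 \<or> f (e 1) $ 3 \<noteq> 0" "f (e 3) $ 1 \<noteq> 0 \<or> f (e 3) $ 3 \<noteq> 0"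
    using coords by (auto simp: vec_eq_iff forall_5)
  then have cases: "(f (e 2) $ 2, f (e 2) $ 4, f (e 4) $ 2, f (e 4) $ 4) = (1, 0, 0, 1) \<or>
      (f (e 2) $ 2, f (e 2) $ 4, f (e 4) $ 2, f (e 4) $ 4) = (0, 1, 1, 0)"
    using weights1 weights3 by auto
  \<comment> \<open>The fifth coordinates of the products of \<open>e\<^sub>2\<close> and \<open>e\<^sub>4\<close> compare the two forms.\<close>
  have "?m (e 2) (e 2) = a *s e 5" "?m (e 2) (e 4) = b *s e 5" "?m (e 4) (e 4) = c *s e 5"
    by (simp_all add: vec_eq_iff forall_5 G_extension_nth e_nth)
  then have "?n (f (e 2)) (f (e 2)) = (a * k) *s e 5" "?n (f (e 2)) (f (e 4)) = (b * k) *s e 5"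
    "?n (f (e 4)) (f (e 4)) = (c * k) *s e 5"
    using hom by (simp_all add: hom[symmetric] f e5)
  then have "?n (f (e 2)) (f (e 2)) $ 5 = a * k" "?n (f (e 2)) (f (e 4)) $ 5 = b * k"
    "?n (f (e 4)) (f (e 4)) $ 5 = c * k"
    by (simp_all add: e_nth)
  then have "(a', b', c') = (k * a, k * b, k * c) \<or> (a', b', c') = (k * c, k * b, k * a)"
    using cases by (auto simp: G_extension_nth mult.commute)
  with \<open>k \<noteq> 0\<close> show ?thesis by blast
qed

lemma G_extension_isomorphic_iff:
  "algebra_isomorphic (*s) (G_extension a b c) (*s) (G_extension a' b' c') \<longleftrightarrow>
    (\<exists>k. k \<noteq> 0 \<and> ((a', b', c') = (k * a, k * b, k * c) \<or> (a', b', c') = (k * c, k * b, k * a)))"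
proof
  assume "algebra_isomorphic (*s) (G_extension a b c) (*s) (G_extension a' b' c')"
  then show "\<exists>k. k \<noteq> 0 \<and>
      ((a', b', c') = (k * a, k * b, k * c) \<or> (a', b', c') = (k * c, k * b, k * a))"
    by (rule G_extension_isomorphic_imp)
next
  assume "\<exists>k. k \<noteq> 0 \<and>
      ((a', b', c') = (k * a, k * b, k * c) \<or> (a', b', c') = (k * c, k * b, k * a))"
  then obtain k where "k \<noteq> 0"
    "(a', b', c') = (k * a, k * b, k * c) \<or> (a', b', c') = (k * c, k * b, k * a)" by blast
  then show "algebra_isomorphic (*s) (G_extension a b c) (*s) (G_extension a' b' c')"
    using G_extension_scale[of k a b c]
      algebra_isomorphic_trans[OF G_extension_swap[of a b c] G_extension_scale[of k c b a]]
    by auto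
qed

section \<open>Degenerate forms split\<close>

text \<open>
  Only the square of \<open>e\<^sub>4\<close> involves \<open>e\<^sub>5\<close>, so the span of \<open>e\<^sub>1, e\<^sub>2\<close> is an ideal, and so is the
  complementary span of \<open>e\<^sub>3, e\<^sub>4, e\<^sub>5\<close>.
\<close>

lemma split_G_extension_zero: "complex_algebra.split (*s) (G_extension 0 0 c)"
proof -
  interpret complex_algebra "(*s)" "G_extension 0 0 c" by (rule complex_algebra_G_extension)
  let ?I = "{x :: complex^5. x $ 3 = 0 \<and> x $ 4 = 0 \<and> x $ 5 = 0}"
  let ?J = "{x :: complex^5. x $ 1 = 0 \<and> x $ 2 = 0}"
  have ideals: "is_ideal ?I" "is_ideal ?J"
    by (auto simp: is_ideal_def vec.subspace_def G_extension_nth)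
  have "e 1 \<in> ?I - {0}" "e 3 \<in> ?J - {0}"
    by (auto simp: e_nth vec_eq_iff forall_5)
  then have nonzero: "?I \<noteq> {0}" "?J \<noteq> {0}"
    by (metis Diff_cancel empty_iff)+
  have disjoint: "?I \<inter> ?J = {0}"
    by (auto simp: vec_eq_iff forall_5)
  have "x \<in> {i + j | i j. i \<in> ?I \<and> j \<in> ?J}" for x
  proof -
    have "x = (x $ 1 *s e 1 + x $ 2 *s e 2) + (x $ 3 *s e 3 + x $ 4 *s e 4 + x $ 5 *s e 5)"
      by (simp add: vec_eq_iff forall_5 e_nth)
    moreover have "x $ 1 *s e 1 + x $ 2 *s e 2 \<in> ?I"
      "x $ 3 *s e 3 + x $ 4 *s e 4 + x $ 5 *s e 5 \<in> ?J"
      by (simp_all add: e_nth)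
    ultimately show ?thesis by blast
  qed
  then have "{i + j | i j. i \<in> ?I \<and> j \<in> ?J} = UNIV"
    by (intro set_eqI iffI UNIV_I)
  with ideals nonzero disjoint show ?thesis
    unfolding split_def by (intro exI[of _ ?I] exI[of _ ?J] conjI)
qed

lemma split_G_extension:
  assumes "b = 0" "a = 0 \<or> c = 0"
  shows "complex_algebra.split (*s) (G_extension a b c)"
  using assms split_G_extension_zero
    split_isomorphic[OF complex_algebra_G_extension complex_algebra_G_extension
      G_extension_swap[of a 0 0]]
  by auto

section \<open>Classification\<close>

lemma isomorphic_G_extension:
  fixes scale :: "complex \<Rightarrow> 'a::ab_group_add \<Rightarrow> 'a"
  assumes A: "symmetric_leibniz_algebra scale mul"
    and iso: "algebra_isomorphic scale (complex_algebra.lie_bracket scale mul) (*s) G_bracket"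
  shows "\<exists>a b c. algebra_isomorphic scale mul (*s) (G_extension a b c)"
proof -
  interpret symmetric_leibniz_algebra scale mul by (rule A)
  obtain f where lin: "Vector_Spaces.linear scale (*s) f" and bij: "bij f"
    and hom: "\<And>x y. f (lie_bracket x y) = G_bracket (f x) (f y)"
    using iso unfolding algebra_isomorphic_def by blast
  have [simp]: "inv f (f x) = x" "f (inv f y) = y" for x y
    using bij by (simp_all add: bij_is_inj bij_is_surj surj_f_inv_f)
  interpret f: module_hom scale "(*s)" f
    using lin by (simp add: Vector_Spaces.linear_iff_module_hom)
  let ?m = "\<lambda>x y. f (mul (inv f x) (inv f y))"
  have "(1/2) *s (?m x y - ?m y x) = G_bracket x y" for x y
    using hom[of "inv f x" "inv f y"] by (simp add: lie_bracket_def f.scale f.diff)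
  then obtain a b c where "?m = G_extension a b c"
    using G_extensionI symmetric_leibniz_algebra_transport[OF A lin bij] by blast
  then have "f (mul x y) = G_extension a b c (f x) (f y)" for x y
    by (metis \<open>\<And>x. inv f (f x) = x\<close>)
  then show ?thesis
    unfolding algebra_isomorphic_def using lin bij by blast
qed

lemma nonsplit_isomorphic_L69_or_L70:
  fixes scale :: "complex \<Rightarrow> 'a::ab_group_add \<Rightarrow> 'a"
  assumes A: "symmetric_leibniz_algebra scale mul"
    and nonsplit: "\<not> complex_algebra.split scale mul"
    and bracket: "algebra_isomorphic scale (complex_algebra.lie_bracket scale mul) (*s) G_bracket"
  shows "(\<exists>\<alpha> \<beta>. algebra_isomorphic scale mul (*s) (L69 \<alpha> \<beta>)) \<or>
    (\<exists>\<alpha>. \<alpha> \<noteq> 0 \<and> algebra_isomorphic scale mul (*s) (L70 \<alpha>))"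
proof -
  obtain a b c where iso: "algebra_isomorphic scale mul (*s) (G_extension a b c)"
    using isomorphic_G_extension[OF A bracket] by blast
  have "\<not> (b = 0 \<and> (a = 0 \<or> c = 0))"
    using nonsplit split_isomorphic[OF _ complex_algebra_G_extension iso] split_G_extension A
    by (auto simp: symmetric_leibniz_algebra_def)
  then consider "b \<noteq> 0" | "b = 0" "a \<noteq> 0" "c \<noteq> 0" by blast
  then show ?thesis
  proof cases
    case 1
    then have "algebra_isomorphic scale mul (*s) (L69 (a / b) (c / b))"
      using algebra_isomorphic_trans[OF iso G_extension_scale[of "1 / b"]]
      by (simp add: L69_eq_G_extension)
    then show ?thesis by blast
  next
    case 2
    then have "algebra_isomorphic scale mul (*s) (L70 (a / c))"
      using algebra_isomorphic_trans[OF iso G_extension_scale[of "1 / c"]]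
      by (simp add: L70_eq_G_extension)
    moreover have "a / c \<noteq> 0" using 2 by simp
    ultimately show ?thesis by blast
  qed
qed

lemma L69_isomorphic_iff:
  "algebra_isomorphic (*s) (L69 \<alpha> \<beta>) (*s) (L69 \<alpha>' \<beta>') \<longleftrightarrow>
    (\<alpha>', \<beta>') = (\<alpha>, \<beta>) \<or> (\<alpha>', \<beta>') = (\<beta>, \<alpha>)"
  (is "?iso \<longleftrightarrow> ?params")
proof
  show ?params if ?iso
    using that unfolding L69_eq_G_extension G_extension_isomorphic_iff by auto
  show ?iso if ?params
    using that unfolding L69_eq_G_extension G_extension_isomorphic_iff
    by (intro exI[of _ 1]) simp
qed

lemma L70_isomorphic_iff:
  assumes "\<alpha> \<noteq> 0"
  shows "algebra_isomorphic (*s) (L70 \<alpha>) (*s) (L70 \<alpha>') \<longleftrightarrow> \<alpha>' = \<alpha> \<or> \<alpha>' = 1 / \<alpha>"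
    (is "?iso \<longleftrightarrow> _")
proof
  assume ?iso
  then obtain k where "\<alpha>' = k * \<alpha> \<and> k = 1 \<or> \<alpha>' = k \<and> k * \<alpha> = 1"
    unfolding L70_eq_G_extension G_extension_isomorphic_iff by fastforce
  then show "\<alpha>' = \<alpha> \<or> \<alpha>' = 1 / \<alpha>"
    using assms by (metis eq_divide_eq mult_1)
next
  assume "\<alpha>' = \<alpha> \<or> \<alpha>' = 1 / \<alpha>"
  then show ?iso
  proof
    assume "\<alpha>' = \<alpha>"
    then show ?iso
      unfolding L70_eq_G_extension G_extension_isomorphic_iff by (intro exI[of _ 1]) simp
  next
    assume "\<alpha>' = 1 / \<alpha>"
    then show ?iso
      unfolding L70_eq_G_extension G_extension_isomorphic_iff
      using assms by (intro exI[of _ "1 / \<alpha>"]) simp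
  qed
qed

lemma L69_not_isomorphic_L70: "\<not> algebra_isomorphic (*s) (L69 \<alpha> \<beta>) (*s) (L70 \<gamma>)"
  unfolding L69_eq_G_extension L70_eq_G_extension G_extension_isomorphic_iff by auto

theorem theorem2p5:
  fixes scale :: "complex \<Rightarrow> 'a::ab_group_add \<Rightarrow> 'a"
    and mul :: "'a \<Rightarrow> 'a \<Rightarrow> 'a"
  shows
    "(symmetric_leibniz_algebra scale mul \<and>
      vector_space.dim scale (UNIV :: 'a set) = 5 \<and>
      complex_algebra.solvable scale mul \<and>
      \<not> complex_algebra.nilpotent scale mul \<and>
      \<not> complex_algebra.split scale mul \<and>
      \<not> complex_algebra.is_Lie mul \<and>
      algebra_isomorphic scale (complex_algebra.lie_bracket scale mul) (*s) G_bracket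
      \<longrightarrow>
        (\<exists>\<alpha> \<beta>. algebra_isomorphic scale mul (*s) (L69 \<alpha> \<beta>)) \<or>
        (\<exists>\<alpha>. \<alpha> \<noteq> 0 \<and> algebra_isomorphic scale mul (*s) (L70 \<alpha>)))
     \<and> (\<forall>\<alpha> \<beta> \<alpha>' \<beta>'. algebra_isomorphic (*s) (L69 \<alpha> \<beta>) (*s) (L69 \<alpha>' \<beta>') \<longleftrightarrow>
          (\<alpha>', \<beta>') = (\<alpha>, \<beta>) \<or> (\<alpha>', \<beta>') = (\<beta>, \<alpha>))
     \<and> (\<forall>\<alpha> \<alpha>'. \<alpha> \<noteq> 0 \<and> \<alpha>' \<noteq> 0 \<longrightarrow>
          (algebra_isomorphic (*s) (L70 \<alpha>) (*s) (L70 \<alpha>') \<longleftrightarrow> \<alpha>' = \<alpha> \<or> \<alpha>' = 1 / \<alpha>))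
     \<and> (\<forall>\<alpha> \<beta> \<gamma>. \<gamma> \<noteq> 0 \<longrightarrow> \<not> algebra_isomorphic (*s) (L69 \<alpha> \<beta>) (*s) (L70 \<gamma>))"
proof (intro conjI allI impI)
  assume "symmetric_leibniz_algebra scale mul \<and>
      vector_space.dim scale (UNIV :: 'a set) = 5 \<and>
      complex_algebra.solvable scale mul \<and>
      \<not> complex_algebra.nilpotent scale mul \<and>
      \<not> complex_algebra.split scale mul \<and>
      \<not> complex_algebra.is_Lie mul \<and>
      algebra_isomorphic scale (complex_algebra.lie_bracket scale mul) (*s) G_bracket"
  then show "(\<exists>\<alpha> \<beta>. algebra_isomorphic scale mul (*s) (L69 \<alpha> \<beta>)) \<or>
      (\<exists>\<alpha>. \<alpha> \<noteq> 0 \<and> algebra_isomorphic scale mul (*s) (L70 \<alpha>))"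
    by (intro nonsplit_isomorphic_L69_or_L70) simp_all
qed (simp_all only: L69_isomorphic_iff L70_isomorphic_iff L69_not_isomorphic_L70 not_False_eq_True)

end
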